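(* Consider an ergodic, metric, measure preserving dynamical system $(X,T,\mu,d)$; in particular $\mu$ is a Borel probability measure on $X$. Let $\widehat{X}\subset X$ be a measurable subset of $X$ with positive measure $\mu$, and let $(\widehat{X},\widehat{T},\widehat{\mu},d)$ be the first return map (induced system) on $\widehat{X}$. Assume that $y\in\operatorname{Int}\widehat{X}$. Then the upper limits of entry times for the original and the induced system coincide, and likewise the lower limits; that is, $$\limsup_{r\to0}\tau_{B(y,r)}(x)\cdot\mu(B(y,r))=\limsup_{r\to0}\widehat{\tau}_{B(y,r)}(x)\cdot\widehat{\mu}(B(y,r))$$ and $$\liminf_{r\to0}\tau_{B(y,r)}(x)\cdot\mu(B(y,r))=\liminf_{r\to0}\widehat{\tau}_{B(y,r)}(x)\cdot\widehat{\mu}(B(y,r))$$ for $\widehat{\mu}$-a.e. $x\in\widehat{X}$.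
   Context: $(X,d)$ is a metric space, and $T\colon X\to X$ is a measurable map that preserves the Borel probability measure $\mu$ and is ergodic with respect to it. $B(y,r)$ is the ball in the metric $d$. $\tau_U(x):=\inf\{k\ge1:T^k(x)\in U\}$ (with $\inf\emptyset=+\infty$) is the first entry time of $x$ into $U$. The first return map is $\widehat{T}(x):=T^{\tau_{\widehat{X}}(x)}(x)$, defined for $\mu$-a.e. $x\in\widehat{X}$, and $\widehat{\mu}(F):=\mu(F)/\mu(\widehat{X})$ for measurable $F\subset\widehat{X}$. For $U\subset\widehat{X}$, $\widehat{\tau}_U(x):=\inf\{k\ge1:\widehat{T}^k(x)\in U\}$ is the first entry time into $U$ for the induced system $(\widehat{X},\widehat{T})$.
   Formalization: The formal theorem additionally assumes μ({y}) = 0 (y is not an atom); without this the claim fails, e.g. for the rotation of {0,1,2} with uniform measure, induced on {0,1}, with y = 0, x = 1 (values 2/3 and 1/2). *)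

theory Defs
  imports "HOL-Probability.Probability"
begin

locale ergodic_metric_system = prob_space M
  for M :: "'a :: metric_space measure" and T :: "'a \<Rightarrow> 'a" +
  assumes sets_eq_borel: "sets M = sets borel"
    and measurable_T: "T \<in> measurable M M"
    and preserves: "distr M M T = M"
    and ergodic: "\<And>A. A \<in> sets M \<Longrightarrow> T -` A = A \<Longrightarrow> prob A = 0 \<or> prob A = 1"

text \<open>In products with measures of balls entry times are read in \<^typ>\<open>ennreal\<close>, where \<open>\<infinity> * 0 = 0\<close>. This convention
  matters only if small balls around the centre \<open>y\<close> are null, and then both products are \<open>0\<close>.

  If \<open>y\<close> is an atom, entry times into \<open>ball y r\<close> stay bounded as \<open>r\<close> tends to \<open>0\<close>, and the limits for a
  system and for its first return map can differ: for the rotation of \<open>{0, 1, 2}\<close> with uniform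
  measure, induced on \<open>{0, 1}\<close>, with \<open>y = 0\<close> and \<open>x = 1\<close>, they are \<open>2/3\<close> and \<open>1/2\<close>.\<close>

definition entry_time :: "('a \<Rightarrow> 'a) \<Rightarrow> 'a set \<Rightarrow> 'a \<Rightarrow> enat" where
  "entry_time T U x = Inf (enat ` {k. 1 \<le> k \<and> (T ^^ k) x \<in> U})"

text \<open>The value \<open>x\<close> in the case \<open>\<infinity>\<close> is a dummy: by Poincare recurrence almost every point of \<open>A\<close>
  returns to \<open>A\<close> infinitely often, so the dummy is met only on a null set of starting points.\<close>

definition first_return :: "('a \<Rightarrow> 'a) \<Rightarrow> 'a set \<Rightarrow> 'a \<Rightarrow> 'a" where
  "first_return T A x = (case entry_time T A x of enat k \<Rightarrow> (T ^^ k) x | \<infinity> \<Rightarrow> x)"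

text \<open>\<^const>\<open>uniform_measure\<close> does not change the underlying space; the restriction makes \<open>A\<close> the
  space of the induced measure.\<close>

definition induced_measure :: "'a measure \<Rightarrow> 'a set \<Rightarrow> 'a measure" where
  "induced_measure M A = restrict_space (uniform_measure M A) A"

lemma emeasure_induced_measure:
  assumes "A \<in> sets M" "F \<in> sets M" "F \<subseteq> A"
  shows "emeasure (induced_measure M A) F = emeasure M F / emeasure M A"
proof -
  have "A \<inter> F = F" using assms(3) by auto
  moreover have "A \<inter> space M = A" using assms(1) sets.sets_into_space by auto
  ultimately show ?thesis
    using assms by (simp add: induced_measure_def emeasure_restrict_space)
qed

end

theory Submission
  imports Defs
begin

text \<open>
  Write \<open>A\<close> for the inducing set, which contains a neighbourhood of \<open>y\<close>. The induced orbit of \<open>x\<close>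
  lists exactly the points of the original orbit that lie in \<open>A\<close>, in the same order. Hence, for a ball
  \<open>U\<close> inside \<open>A\<close>, the induced entry time into \<open>U\<close> is the number of visits to \<open>A\<close> up to and including
  the original entry time \<open>n\<close> (\<open>entry_time_first_return\<close>). By the pointwise ergodic theorem this number
  is asymptotic to \<open>n * prob A\<close>, and the normalisation of the induced measure divides the measure of
  \<open>U\<close> by the same factor \<open>prob A\<close>. So the quotient of the two products tends to \<open>1\<close>, provided that
  \<open>n\<close> tends to infinity as the ball shrinks. This is where \<open>y\<close> must not be an atom: almost every
  orbit then avoids \<open>y\<close>, so it takes ever longer to come close to \<open>y\<close>
  (\<open>eventually_entry_time_ball_large\<close>). A quotient tending to \<open>1\<close> preserves upper and lower limits
  (\<open>Limsup_le_of_eventually_le_mult\<close>). If \<open>x\<close> never enters \<open>U\<close>, both entry times are infinite and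
  the comparison still holds.

  The pointwise ergodic theorem is derived from the maximal ergodic inequality in Garsia's form. For
  an integrable \<open>f\<close> with negative integral, the set of points with Birkhoff sums unbounded above is
  strictly invariant, so it has probability \<open>0\<close> or \<open>1\<close>. Probability \<open>1\<close> would contradict the maximal
  inequality. Applying this to \<open>f\<close> and \<open>- f\<close>, shifted by constants that make the integral slightly
  negative, bounds the averages from both sides.
\<close>

section \<open>Birkhoff sums\<close>

definition birkhoff_sum :: "('a \<Rightarrow> 'a) \<Rightarrow> ('a \<Rightarrow> real) \<Rightarrow> nat \<Rightarrow> 'a \<Rightarrow> real" where
  "birkhoff_sum T f n x = (\<Sum>k<n. f ((T ^^ k) x))"

lemma birkhoff_sum_0 [simp]: "birkhoff_sum T f 0 x = 0"
  by (simp add: birkhoff_sum_def)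

lemma birkhoff_sum_Suc: "birkhoff_sum T f (Suc n) x = f x + birkhoff_sum T f n (T x)"
  by (simp add: birkhoff_sum_def sum.lessThan_Suc_shift funpow_swap1 del: sum.lessThan_Suc)

text \<open>The recursion computes the maximum of the Birkhoff sums of lengths \<open>0\<close> to \<open>n\<close>. It is chosen
  as the definition because integrability and the inequality of Garsia's argument are both read off
  from one step of it.\<close>

primrec max_birkhoff_sum :: "('a \<Rightarrow> 'a) \<Rightarrow> ('a \<Rightarrow> real) \<Rightarrow> nat \<Rightarrow> 'a \<Rightarrow> real" where
  "max_birkhoff_sum T f 0 x = 0"
| "max_birkhoff_sum T f (Suc n) x = max 0 (f x + max_birkhoff_sum T f n (T x))"

lemma max_birkhoff_sum_nonneg: "0 \<le> max_birkhoff_sum T f n x"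
  by (cases n) auto

lemma max_birkhoff_sum_mono_Suc: "max_birkhoff_sum T f n x \<le> max_birkhoff_sum T f (Suc n) x"
proof (induction n arbitrary: x)
  case (Suc n)
  have "f x + max_birkhoff_sum T f n (T x) \<le> f x + max_birkhoff_sum T f (Suc n) (T x)"
    using Suc.IH by (rule add_left_mono)
  then show ?case
    by (metis max.mono max_birkhoff_sum.simps(2) order_refl)
qed simp

lemma birkhoff_sum_le_max: "k \<le> n \<Longrightarrow> birkhoff_sum T f k x \<le> max_birkhoff_sum T f n x"
proof (induction n arbitrary: k x)
  case (Suc n)
  show ?case
  proof (cases k)
    case (Suc j)
    then have "birkhoff_sum T f j (T x) \<le> max_birkhoff_sum T f n (T x)"
      using Suc.IH Suc.prems by simp
    then show ?thesis
      by (simp add: Suc birkhoff_sum_Suc le_max_iff_disj)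
  qed (simp add: le_max_iff_disj)
qed simp

section \<open>The pointwise ergodic theorem\<close>

context ergodic_metric_system
begin

lemma space_UNIV: "space M = UNIV"
  using sets_eq_imp_space_eq[OF sets_eq_borel] by simp

lemma measurable_iterate: "T ^^ k \<in> measurable M M"
proof (induction k)
  case (Suc k)
  then show ?case
    using measurable_T by (simp add: measurable_comp)
qed (simp add: id_def)

lemma integrable_comp_T:
  fixes f :: "'a \<Rightarrow> real"
  shows "integrable M f \<Longrightarrow> integrable M (\<lambda>x. f (T x))"
  by (rule integrable_distr[OF measurable_T]) (simp add: preserves)

lemma integral_comp_T:
  fixes f :: "'a \<Rightarrow> real"
  shows "integrable M f \<Longrightarrow> (\<integral>x. f (T x) \<partial>M) = (\<integral>x. f x \<partial>M)"
  using integral_distr[OF measurable_T, of f] by (simp add: preserves borel_measurable_integrable)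

lemma integrable_max_birkhoff_sum:
  "integrable M f \<Longrightarrow> integrable M (max_birkhoff_sum T f n)"
proof (induction n)
  case (Suc n)
  then have "integrable M (\<lambda>x. max 0 (f x + max_birkhoff_sum T f n (T x)))"
    using integrable_comp_T[of "max_birkhoff_sum T f n"]
    by (intro integrable_max Bochner_Integration.integrable_add) auto
  then show ?case
    by (simp only: max_birkhoff_sum.simps[abs_def])
qed (simp add: max_birkhoff_sum.simps[abs_def])

text \<open>Garsia's argument: write \<open>m n\<close> for the maximal function. Where \<open>m (n + 1)\<close> is positive, the
  recursion says that \<open>f = m (n + 1) - m n \<circ> T\<close>; elsewhere that difference is at most \<open>0\<close>. Its
  integral is nonnegative because \<open>T\<close> preserves the measure and \<open>m\<close> increases with \<open>n\<close>.\<close>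

lemma maximal_ergodic_inequality:
  assumes f: "integrable M f"
  shows "0 \<le> (\<integral>x. indicator {x. 0 < max_birkhoff_sum T f n x} x * f x \<partial>M)"
proof (cases n)
  case (Suc m)
  let ?m = "max_birkhoff_sum T f m" and ?n = "max_birkhoff_sum T f n"
  note [measurable] = borel_measurable_integrable[OF f]
    borel_measurable_integrable[OF integrable_max_birkhoff_sum[OF f, of n]]
  have mi: "integrable M ?m" and ni: "integrable M ?n"
    using integrable_max_birkhoff_sum[OF f] by auto
  have mi': "integrable M (\<lambda>x. ?m (T x))"
    by (rule integrable_comp_T[OF mi])
  have meas: "{x. 0 < ?n x} \<in> sets M"
  proof -
    have "{x \<in> space M. 0 < ?n x} \<in> sets M" by measurable
    then show ?thesis by (simp add: space_UNIV)
  qed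
  have "(\<integral>x. ?n x \<partial>M) \<ge> (\<integral>x. ?m x \<partial>M)"
    unfolding Suc by (intro integral_mono integrable_max_birkhoff_sum f max_birkhoff_sum_mono_Suc)
  then have "0 \<le> (\<integral>x. ?n x - ?m (T x) \<partial>M)"
    by (simp add: Bochner_Integration.integral_diff[OF ni mi'] integral_comp_T[OF mi])
  also have "\<dots> \<le> (\<integral>x. indicator {x. 0 < ?n x} x * f x \<partial>M)"
  proof (rule integral_mono)
    show "integrable M (\<lambda>x. ?n x - ?m (T x))"
      by (intro Bochner_Integration.integrable_diff ni mi')
    show "integrable M (\<lambda>x. indicator {x. 0 < ?n x} x * f x)"
      using integrable_mult_indicator[OF meas f] by simp
    show "?n x - ?m (T x) \<le> indicator {x. 0 < ?n x} x * f x" for x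
      using max_birkhoff_sum_nonneg[of T f m "T x"] by (auto simp: Suc indicator_def max_def)
  qed
  finally show ?thesis .
qed simp

text \<open>The sets in the maximal inequality increase to a set of full measure, so the inequality passes
  to the limit by dominated convergence.\<close>

lemma integral_nonneg_of_positive_birkhoff_sum:
  assumes f: "integrable M f" and pos: "AE x in M. \<exists>n. 0 < birkhoff_sum T f n x"
  shows "0 \<le> (\<integral>x. f x \<partial>M)"
proof -
  let ?s = "\<lambda>n x. indicator {x. 0 < max_birkhoff_sum T f n x} x * f x"
  have "(\<lambda>n. \<integral>x. ?s n x \<partial>M) \<longlonglongrightarrow> (\<integral>x. f x \<partial>M)"
  proof (rule integral_dominated_convergence[where w = "\<lambda>x. \<bar>f x\<bar>"])
    show "f \<in> borel_measurable M"
      using f by simp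
    show "integrable M (\<lambda>x. \<bar>f x\<bar>)"
      using f by simp
    show "?s n \<in> borel_measurable M" for n
    proof -
      note [measurable] = borel_measurable_integrable[OF f]
        borel_measurable_integrable[OF integrable_max_birkhoff_sum[OF f, of n]]
      have "(\<lambda>x. (if 0 < max_birkhoff_sum T f n x then 1 else 0) * f x) \<in> borel_measurable M"
        by measurable
      then show ?thesis
        by (simp add: indicator_def of_bool_def)
    qed
    show "AE x in M. (\<lambda>n. ?s n x) \<longlonglongrightarrow> f x"
      using pos
    proof eventually_elim
      case (elim x)
      then obtain k where "0 < birkhoff_sum T f k x"
        by blast
      then have "?s n x = f x" if "k \<le> n" for n
        using birkhoff_sum_le_max[OF that, of T f x] by simp
      then show ?case
        by (intro tendsto_eventually) (auto simp: eventually_sequentially)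
    qed
    show "AE x in M. norm (?s n x) \<le> \<bar>f x\<bar>" for n
      by (intro always_eventually) (simp add: indicator_def)
  qed
  then show ?thesis
    by (rule LIMSEQ_le_const) (use maximal_ergodic_inequality[OF f] in blast)
qed

text \<open>Unboundedness, unlike a bound on the upper limit of the averages, is visibly strictly invariant:
  the Birkhoff sums at \<open>x\<close> and at \<open>T x\<close> differ, after a shift of the index, by the single number
  \<open>f x\<close>.\<close>

lemma AE_birkhoff_sum_bounded_above:
  assumes f: "integrable M f" and neg: "(\<integral>x. f x \<partial>M) < 0"
  shows "AE x in M. \<exists>K. \<forall>n. birkhoff_sum T f n x \<le> K"
proof -
  define E where "E = {x. \<forall>K::nat. \<exists>n. real K < birkhoff_sum T f n x}"
  have [measurable]: "birkhoff_sum T f n \<in> borel_measurable M" for n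
    unfolding birkhoff_sum_def
    by (intro borel_measurable_sum measurable_compose[OF measurable_iterate]
        borel_measurable_integrable f)
  have "{x \<in> space M. \<forall>K::nat. \<exists>n. real K < birkhoff_sum T f n x} \<in> sets M"
    by measurable
  then have sets_E: "E \<in> sets M"
    by (simp add: E_def space_UNIV)
  have "x \<in> E" if Tx: "T x \<in> E" for x
    unfolding E_def
  proof (intro CollectI allI)
    fix K :: nat
    obtain L :: nat where L: "real K + \<bar>f x\<bar> \<le> real L"
      using real_arch_simple by blast
    obtain n where "real L < birkhoff_sum T f n (T x)"
      using Tx unfolding E_def by blast
    then have "real K < birkhoff_sum T f (Suc n) x"
      using L by (simp add: birkhoff_sum_Suc)
    then show "\<exists>n. real K < birkhoff_sum T f n x" ..
  qed
  moreover have "T x \<in> E" if "x \<in> E" for x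
    unfolding E_def
  proof (intro CollectI allI)
    fix K :: nat
    obtain L :: nat where L: "real K + \<bar>f x\<bar> \<le> real L"
      using real_arch_simple by blast
    obtain n where n: "real L < birkhoff_sum T f n x"
      using \<open>x \<in> E\<close> unfolding E_def by blast
    then obtain m where "n = Suc m"
      by (cases n) auto
    then have "real K < birkhoff_sum T f m (T x)"
      using n L by (simp add: birkhoff_sum_Suc)
    then show "\<exists>n. real K < birkhoff_sum T f n (T x)" ..
  qed
  ultimately have "T -` E = E"
    by auto
  then have "prob E = 0 \<or> prob E = 1"
    by (rule ergodic[OF sets_E])
  moreover have "prob E \<noteq> 1"
  proof
    assume "prob E = 1"
    then have "AE x in M. x \<in> E"
      using sets_E prob_eq_1 by simp
    then have "AE x in M. \<exists>n. 0 < birkhoff_sum T f n x"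
    proof eventually_elim
      case (elim x)
      then obtain n where "real 0 < birkhoff_sum T f n x"
        unfolding E_def by blast
      then show ?case by auto
    qed
    then show False
      using integral_nonneg_of_positive_birkhoff_sum[OF f] neg by simp
  qed
  ultimately have "AE x in M. x \<notin> E"
    using sets_E prob_eq_0 by blast
  then show ?thesis
  proof eventually_elim
    case (elim x)
    then show ?case
      unfolding E_def by (auto simp: not_less)
  qed
qed

text \<open>A bound \<open>K\<close> on the Birkhoff sums of \<open>f - I - 1 / (j + 1)\<close>, where \<open>I\<close> is the integral of \<open>f\<close>,
  shows that the averages of \<open>f\<close> are at most \<open>I + 1 / (j + 1) + K / n\<close>; the lower bound comes from
  \<open>- f\<close>.\<close>

lemma birkhoff_pointwise:
  assumes f: "integrable M f"
  shows "AE x in M. (\<lambda>n. birkhoff_sum T f n x / n) \<longlonglongrightarrow> (\<integral>x. f x \<partial>M)"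
proof -
  define I where "I = (\<integral>x. f x \<partial>M)"
  have sums: "birkhoff_sum T (\<lambda>x. a * f x - c) n x = a * birkhoff_sum T f n x - n * c" for a c n x
    by (simp add: birkhoff_sum_def sum_subtractf sum_distrib_left)
  have one_sided: "AE x in M. \<forall>j. \<exists>K. \<forall>n. a * birkhoff_sum T f n x
      - n * (a * I + 1 / real (Suc j)) \<le> K" for a
  proof (subst AE_all_countable, intro allI)
    fix j
    have "AE x in M. \<exists>K. \<forall>n. birkhoff_sum T (\<lambda>x. a * f x - (a * I + 1 / real (Suc j))) n x \<le> K"
      by (rule AE_birkhoff_sum_bounded_above) (use f prob_space in \<open>auto simp: I_def\<close>)
    then show "AE x in M. \<exists>K. \<forall>n. a * birkhoff_sum T f n x - n * (a * I + 1 / real (Suc j)) \<le> K"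
      unfolding sums .
  qed
  show ?thesis
    using one_sided[of 1] one_sided[of "- 1"] unfolding I_def[symmetric]
  proof eventually_elim
    case (elim x)
    show ?case
    proof (rule LIMSEQ_I)
      fix e :: real
      assume "0 < e"
      then obtain j where j: "1 / real (Suc j) < e / 2"
        using nat_approx_posE[of "e / 2"] by (metis half_gt_zero)
      obtain K where K: "\<And>n. 1 * birkhoff_sum T f n x - n * (1 * I + 1 / real (Suc j)) \<le> K"
        using elim(1) by blast
      obtain L where L: "\<And>n. - 1 * birkhoff_sum T f n x - n * (- 1 * I + 1 / real (Suc j)) \<le> L"
        using elim(2) by blast
      \<comment> \<open>For \<open>n > N\<close> the constants \<open>K\<close> and \<open>L\<close> cost at most \<open>e / 2\<close> after division by \<open>n\<close>, and the
        shift by \<open>1 / (j + 1)\<close> costs less than \<open>e / 2\<close>.\<close>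
      obtain N where N: "2 * (\<bar>K\<bar> + \<bar>L\<bar>) / e < real N"
        using reals_Archimedean2 by blast
      have bound: "\<bar>D\<bar> < P"
        if "2 * (\<bar>K\<bar> + \<bar>L\<bar>) < P" "2 * q < P" "D \<le> K + q" "- D \<le> L + q" for P q D :: real
      proof -
        have "K \<le> \<bar>K\<bar>" "L \<le> \<bar>L\<bar>" "0 \<le> \<bar>K\<bar>" "0 \<le> \<bar>L\<bar>"
          by auto
        then show ?thesis
          unfolding abs_less_iff using that by argo
      qed
      have "norm (birkhoff_sum T f n x / n - I) < e" if "Suc N \<le> n" for n
      proof -
        have n: "0 < real n"
          using that by simp
        have "2 * (\<bar>K\<bar> + \<bar>L\<bar>) < real n * e"
        proof -
          have "2 * (\<bar>K\<bar> + \<bar>L\<bar>) < real N * e"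
            using N \<open>0 < e\<close> by (simp add: divide_less_eq)
          also have "\<dots> \<le> real n * e"
            using that \<open>0 < e\<close> by (intro mult_right_mono) auto
          finally show ?thesis .
        qed
        moreover have "2 * (real n * (1 / real (Suc j))) < real n * e"
          using mult_strict_left_mono[OF j n] by (simp add: mult.commute)
        moreover have "birkhoff_sum T f n x - n * I \<le> K + real n * (1 / real (Suc j))"
          using K[of n] by (simp add: algebra_simps)
        moreover have "- (birkhoff_sum T f n x - n * I) \<le> L + real n * (1 / real (Suc j))"
          using L[of n] by (simp add: algebra_simps)
        ultimately have "\<bar>birkhoff_sum T f n x - n * I\<bar> < real n * e"
          by (rule bound)
        moreover have "birkhoff_sum T f n x / n - I = (birkhoff_sum T f n x - n * I) / n"
          using n by (simp add: field_simps)
        ultimately show ?thesis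
          using n by (simp add: abs_divide pos_divide_less_eq mult.commute)
      qed
      then show "\<exists>N. \<forall>n\<ge>N. norm (birkhoff_sum T f n x / n - I) < e"
        by blast
    qed
  qed
qed

text \<open>Visits are counted from time \<open>1\<close>, as entry times are; so the Birkhoff sums are those of the
  indicator of \<open>A\<close> composed with \<open>T\<close>.\<close>

lemma AE_visit_frequency:
  assumes A: "A \<in> sets M"
  shows "AE x in M. (\<lambda>n. real (card {k \<in> {1..n}. (T ^^ k) x \<in> A}) / n) \<longlonglongrightarrow> prob A"
proof -
  have int: "integrable M (indicator A :: 'a \<Rightarrow> real)"
    using A by (simp add: integrable_indicator_iff less_top[symmetric])
  have count: "birkhoff_sum T (\<lambda>x. indicator A (T x)) n x = card {k \<in> {1..n}. (T ^^ k) x \<in> A}" for n x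
  proof -
    have "birkhoff_sum T (\<lambda>x. indicator A (T x)) n x = (\<Sum>k<n. indicator A ((T ^^ Suc k) x))"
      by (simp add: birkhoff_sum_def)
    also have "\<dots> = (\<Sum>k\<in>{1..n}. indicator A ((T ^^ k) x))"
      by (rule sum.reindex_bij_witness[of _ "\<lambda>k. k - 1" Suc]) auto
    also have "\<dots> = (\<Sum>k\<in>{1..n}. if (T ^^ k) x \<in> A then 1 else 0)"
      by (simp add: indicator_def of_bool_def)
    also have "\<dots> = card {k \<in> {1..n}. (T ^^ k) x \<in> A}"
      by (subst sum.inter_filter[symmetric]) auto
    finally show ?thesis .
  qed
  have "(\<integral>x. indicator A (T x) \<partial>M) = prob A"
    using integral_comp_T[OF int] A by simp
  then show ?thesis
    using birkhoff_pointwise[OF integrable_comp_T[OF int]] by (simp add: count)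
qed

lemma AE_orbit_avoids_null_set:
  assumes "emeasure M N = 0" "N \<in> sets M"
  shows "AE x in M. \<forall>k. (T ^^ k) x \<notin> N"
proof (subst AE_all_countable, intro allI)
  fix k
  show "AE x in M. (T ^^ k) x \<notin> N"
  proof (induction k)
    case 0
    show ?case
      using assms by (auto intro: AE_not_in simp: null_sets_def)
  next
    case (Suc k)
    have "AE x in distr M M T. (T ^^ k) x \<notin> N"
      unfolding preserves by (rule Suc)
    then have "AE x in M. (T ^^ k) (T x) \<notin> N"
      by (rule AE_distrD[OF measurable_T])
    then show ?case
      by (simp add: funpow_swap1)
  qed
qed

end

section \<open>Entry times of the first return map\<close>

lemma entry_time_eq_enat_iff:
  "entry_time T U x = enat n \<longleftrightarrow> 1 \<le> n \<and> (T ^^ n) x \<in> U \<and> (\<forall>k. 1 \<le> k \<and> k < n \<longrightarrow> (T ^^ k) x \<notin> U)"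
proof
  assume eq: "entry_time T U x = enat n"
  let ?S = "{k. 1 \<le> k \<and> (T ^^ k) x \<in> U}"
  have "?S \<noteq> {}"
  proof
    assume "?S = {}"
    then have "entry_time T U x = \<infinity>"
      by (simp only: entry_time_def image_empty Inf_empty top_enat_def)
    then show False
      using eq by simp
  qed
  then have "enat ` ?S \<noteq> {}"
    by blast
  then have "Inf (enat ` ?S) \<in> enat ` ?S"
    by (metis (no_types, lifting) equals0I wellorder_InfI)
  then have "n \<in> ?S"
    using eq by (auto simp: entry_time_def)
  moreover have "n \<le> k" if "k \<in> ?S" for k
  proof -
    have "Inf (enat ` ?S) \<le> enat k"
      using that by (intro Inf_lower) auto
    then show ?thesis
      using eq by (simp add: entry_time_def)
  qed
  ultimately show "1 \<le> n \<and> (T ^^ n) x \<in> U \<and> (\<forall>k. 1 \<le> k \<and> k < n \<longrightarrow> (T ^^ k) x \<notin> U)"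
    by (auto simp: not_le[symmetric])
next
  assume n: "1 \<le> n \<and> (T ^^ n) x \<in> U \<and> (\<forall>k. 1 \<le> k \<and> k < n \<longrightarrow> (T ^^ k) x \<notin> U)"
  show "entry_time T U x = enat n"
    unfolding entry_time_def
  proof (rule Inf_eqI)
    fix i
    assume "i \<in> enat ` {k. 1 \<le> k \<and> (T ^^ k) x \<in> U}"
    then show "enat n \<le> i"
      using n by (force simp: not_less[symmetric])
  qed (use n in auto)
qed

lemma entry_time_eq_infinity_iff:
  "entry_time T U x = \<infinity> \<longleftrightarrow> (\<forall>k\<ge>1. (T ^^ k) x \<notin> U)"
proof
  assume inf: "entry_time T U x = \<infinity>"
  show "\<forall>k\<ge>1. (T ^^ k) x \<notin> U"
  proof (intro allI impI notI)
    fix k :: nat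
    assume "1 \<le> k" "(T ^^ k) x \<in> U"
    then have "entry_time T U x \<le> enat k"
      unfolding entry_time_def by (intro Inf_lower) auto
    then show False
      using inf by simp
  qed
next
  assume "\<forall>k\<ge>1. (T ^^ k) x \<notin> U"
  then have "{k. 1 \<le> k \<and> (T ^^ k) x \<in> U} = {}"
    by auto
  then show "entry_time T U x = \<infinity>"
    by (simp only: entry_time_def image_empty Inf_empty top_enat_def)
qed

text \<open>The induced orbit runs through the successive visit times; since enumeration starts at index
  \<open>0\<close> and the first return has positive time,
  \<open>j + 1\<close> induced steps lead to the visit with index \<open>j\<close>. With infinitely many visits, all
  return times along the orbit are finite.\<close>

lemma iterate_first_return:
  assumes inf: "infinite {k. 1 \<le> k \<and> (T ^^ k) x \<in> A}"
  shows "(first_return T A ^^ Suc j) x = (T ^^ enumerate {k. 1 \<le> k \<and> (T ^^ k) x \<in> A} j) x"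
proof (induction j)
  case 0
  let ?V = "{k. 1 \<le> k \<and> (T ^^ k) x \<in> A}"
  have "entry_time T A x = enat (enumerate ?V 0)"
    unfolding entry_time_eq_enat_iff
    using enumerate_in_set[OF inf, of 0] by (auto simp: enumerate_0 dest: not_less_Least)
  then show ?case
    by (simp add: first_return_def)
next
  case (Suc j)
  let ?V = "{k. 1 \<le> k \<and> (T ^^ k) x \<in> A}"
  define m n where "m = enumerate ?V j" and "n = enumerate ?V (Suc j)"
  have "m < n"
    unfolding m_def n_def by (rule enumerate_step[OF inf])
  have orbit: "(T ^^ k) ((T ^^ m) x) = (T ^^ (k + m)) x" for k
    by (simp add: funpow_add)
  have "entry_time T A ((T ^^ m) x) = enat (n - m)"
    unfolding entry_time_eq_enat_iff orbit
  proof (intro conjI allI impI)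
    show "1 \<le> n - m"
      using \<open>m < n\<close> by simp
    show "(T ^^ (n - m + m)) x \<in> A"
      using enumerate_in_set[OF inf, of "Suc j"] \<open>m < n\<close> by (simp add: n_def)
    fix k
    assume k: "1 \<le> k \<and> k < n - m"
    have "n = (LEAST s. s \<in> ?V \<and> m < s)"
      unfolding n_def m_def by (rule enumerate_Suc''[OF inf])
    moreover have "k + m < n"
      using k by linarith
    ultimately have "\<not> (k + m \<in> ?V \<and> m < k + m)"
      by (metis (no_types, lifting) not_less_Least)
    then show "(T ^^ (k + m)) x \<notin> A"
      using k by simp
  qed
  then have "first_return T A ((T ^^ m) x) = (T ^^ n) x"
    using orbit[of "n - m"] \<open>m < n\<close> by (simp add: first_return_def)
  then show ?case
    using Suc by (simp add: m_def n_def)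
qed

text \<open>Since \<open>U\<close> lies inside \<open>A\<close>, the entry into \<open>U\<close> happens at a visit to \<open>A\<close>, and counting the
  visits up to that moment converts original time into induced time.\<close>

lemma entry_time_first_return:
  assumes inf: "infinite {k. 1 \<le> k \<and> (T ^^ k) x \<in> A}" and "U \<subseteq> A"
  shows "entry_time (first_return T A) U x =
    (case entry_time T U x of enat n \<Rightarrow> enat (card {k \<in> {1..n}. (T ^^ k) x \<in> A}) | \<infinity> \<Rightarrow> \<infinity>)"
proof (cases "entry_time T U x")
  case (enat n)
  let ?V = "{k. 1 \<le> k \<and> (T ^^ k) x \<in> A}"
  have n: "1 \<le> n" "(T ^^ n) x \<in> U" "\<And>k. 1 \<le> k \<Longrightarrow> k < n \<Longrightarrow> (T ^^ k) x \<notin> U"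
    using enat unfolding entry_time_eq_enat_iff by auto
  then have "n \<in> ?V"
    using \<open>U \<subseteq> A\<close> by auto
  obtain j where j: "enumerate ?V j = n"
    using enumerate_Ex[OF inf \<open>n \<in> ?V\<close>] by blast
  have "{k \<in> {1..n}. (T ^^ k) x \<in> A} = enumerate ?V ` {..j}"
  proof (intro equalityI subsetI)
    fix k
    assume k: "k \<in> {k \<in> {1..n}. (T ^^ k) x \<in> A}"
    then have "k \<in> ?V"
      by simp
    obtain i where i: "enumerate ?V i = k"
      using enumerate_Ex[OF inf \<open>k \<in> ?V\<close>] by blast
    then have "enumerate ?V i \<le> enumerate ?V j"
      using k j by simp
    then show "k \<in> enumerate ?V ` {..j}"
      using i inf by auto
  next
    fix k
    assume "k \<in> enumerate ?V ` {..j}"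
    then obtain i where "i \<le> j" "k = enumerate ?V i"
      by auto
    then show "k \<in> {k \<in> {1..n}. (T ^^ k) x \<in> A}"
      using enumerate_in_set[OF inf, of i] j enumerate_mono_le_iff[OF inf, of i j] by auto
  qed
  then have card: "card {k \<in> {1..n}. (T ^^ k) x \<in> A} = Suc j"
    using card_image[OF inj_on_subset[OF inj_enumerate[OF inf] subset_UNIV], of "{..j}"] by simp
  have "entry_time (first_return T A) U x = enat (Suc j)"
    unfolding entry_time_eq_enat_iff
  proof (intro conjI allI impI)
    show "(first_return T A ^^ Suc j) x \<in> U"
      unfolding iterate_first_return[OF inf] j by (rule n)
    fix k
    assume k: "1 \<le> k \<and> k < Suc j"
    then obtain i where i: "k = Suc i" "i < j"
      by (cases k) auto
    then have "enumerate ?V i < n"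
      using enumerate_mono[OF \<open>i < j\<close> inf] j by simp
    moreover have "1 \<le> enumerate ?V i"
      using enumerate_in_set[OF inf, of i] by simp
    ultimately show "(first_return T A ^^ k) x \<notin> U"
      unfolding i iterate_first_return[OF inf] using n(3) by blast
  qed simp
  then show ?thesis
    unfolding enat enat.case card .
next
  case infinity
  have "(first_return T A ^^ k) x \<notin> U" if k: "1 \<le> k" for k
  proof -
    obtain i where i: "k = Suc i"
      using k by (cases k) auto
    show ?thesis
      unfolding i iterate_first_return[OF inf]
      using infinity enumerate_in_set[OF inf, of i] by (auto simp: entry_time_eq_infinity_iff)
  qed
  then show ?thesis
    by (simp add: infinity entry_time_eq_infinity_iff)
qed

section \<open>Comparison of the limits\<close>

lemma eventually_ball_subset:
  assumes "y \<in> interior A"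
  shows "\<forall>\<^sub>F r in at_right (0::real). ball y r \<subseteq> A"
proof -
  obtain d where "0 < d" and d: "ball y d \<subseteq> A"
    using assms by (auto simp: mem_interior)
  show ?thesis
    using order_tendstoD(2)[OF tendsto_ident_at \<open>0 < d\<close>]
    by (rule eventually_mono) (use d in force)
qed

text \<open>The first \<open>N\<close> points of the orbit have a positive distance from \<open>y\<close>.\<close>

lemma eventually_entry_time_ball_large:
  assumes "\<forall>k. (T ^^ k) x \<noteq> y"
  shows "\<forall>\<^sub>F r in at_right (0::real). enat N \<le> entry_time T (ball y r) x"
proof -
  have "\<forall>\<^sub>F r in at_right 0. \<forall>k\<in>{..<N}. r < dist y ((T ^^ k) x)"
  proof (rule eventually_ball_finite, simp, intro ballI)
    fix k
    have "0 < dist y ((T ^^ k) x)"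
      using assms by (metis zero_less_dist_iff)
    then show "\<forall>\<^sub>F r in at_right 0. r < dist y ((T ^^ k) x)"
      by (rule order_tendstoD(2)[OF tendsto_ident_at])
  qed
  then show ?thesis
  proof eventually_elim
    case (elim r)
    show ?case
    proof (cases "entry_time T (ball y r) x")
      case (enat n)
      then have "(T ^^ n) x \<in> ball y r"
        by (simp add: entry_time_eq_enat_iff)
      then show ?thesis
        using elim enat by (force simp: not_less[symmetric])
    qed simp
  qed
qed

text \<open>The comparison is by a factor and not by a quotient, which keeps it meaningful at the values
  \<open>0\<close> and \<open>\<infinity>\<close>. Multiplication by a finite constant is continuous and monotone on \<^typ>\<open>ennreal\<close>, so
  it commutes with both limits; then \<open>e\<close> tends to \<open>0\<close>.\<close>

lemma Limsup_le_of_eventually_le_mult: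
  fixes f g :: "'b \<Rightarrow> ennreal"
  assumes F: "F \<noteq> bot"
    and le: "\<And>e. 0 < e \<Longrightarrow> \<forall>\<^sub>F r in F. g r \<le> ennreal (1 + e) * f r"
  shows "Limsup F g \<le> Limsup F f" and "Liminf F g \<le> Liminf F f"
proof -
  have cont: "continuous_on UNIV (\<lambda>x. ennreal (1 + e) * x)" for e
    by (intro ennreal_continuous_on_cmult continuous_on_id) auto
  have mono: "mono (\<lambda>x. ennreal (1 + e) * x)" for e
    by (intro monoI mult_left_mono) auto
  have lim: "a \<le> b" if ab: "\<And>e. 0 < e \<Longrightarrow> a \<le> ennreal (1 + e) * b" for a b :: ennreal
  proof (rule tendsto_lowerbound)
    have "((\<lambda>e. ennreal (1 + e)) \<longlongrightarrow> ennreal (1 + 0)) (at_right 0)"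
      by (intro tendsto_intros tendsto_ennrealI)
    then show "((\<lambda>e. ennreal (1 + e) * b) \<longlongrightarrow> b) (at_right 0)"
      using tendsto_mult_ennreal[of "\<lambda>e. ennreal (1 + e)" 1 "at_right 0" "\<lambda>_. b" b] by auto
    show "\<forall>\<^sub>F e in at_right (0::real). a \<le> ennreal (1 + e) * b"
      using ab by (auto simp: eventually_at_right_field intro: exI[of _ 1])
  qed simp
  show "Limsup F g \<le> Limsup F f"
  proof (rule lim)
    fix e :: real
    assume "0 < e"
    have "Limsup F g \<le> Limsup F (\<lambda>r. ennreal (1 + e) * f r)"
      by (rule Limsup_mono[OF le[OF \<open>0 < e\<close>]])
    also have "\<dots> = ennreal (1 + e) * Limsup F f"
      by (rule Limsup_compose_continuous_mono[OF cont mono F])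
    finally show "Limsup F g \<le> ennreal (1 + e) * Limsup F f" .
  qed
  show "Liminf F g \<le> Liminf F f"
  proof (rule lim)
    fix e :: real
    assume "0 < e"
    have "Liminf F g \<le> Liminf F (\<lambda>r. ennreal (1 + e) * f r)"
      by (rule Liminf_mono[OF le[OF \<open>0 < e\<close>]])
    also have "\<dots> = ennreal (1 + e) * Liminf F f"
      by (rule Liminf_compose_continuous_mono[OF cont mono F])
    finally show "Liminf F g \<le> ennreal (1 + e) * Liminf F f" .
  qed
qed

lemma infinite_visits_of_frequency:
  assumes "(\<lambda>n. real (card {k \<in> {1..n}. (T ^^ k) x \<in> A}) / n) \<longlonglongrightarrow> p" and "0 < p"
  shows "infinite {k. 1 \<le> k \<and> (T ^^ k) x \<in> A}"
proof
  let ?V = "{k. 1 \<le> k \<and> (T ^^ k) x \<in> A}"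
  assume fin: "finite ?V"
  have "(\<lambda>n. real (card {k \<in> {1..n}. (T ^^ k) x \<in> A}) / n) \<longlonglongrightarrow> 0"
  proof (rule tendsto_sandwich[of "\<lambda>_. 0"])
    show "(\<lambda>n. real (card ?V) / real n) \<longlonglongrightarrow> 0"
      by (rule lim_const_over_n)
    show "\<forall>\<^sub>F n in sequentially. real (card {k \<in> {1..n}. (T ^^ k) x \<in> A}) / n \<le> real (card ?V) / n"
      by (intro always_eventually allI divide_right_mono of_nat_mono card_mono fin) auto
  qed auto
  then show False
    using assms LIMSEQ_unique by fastforce
qed

text \<open>The factor \<open>m r\<close> stands for the measure of the ball and \<open>m r / p\<close> for its induced measure, so
  that only the entry times remain to be compared: for a long entry time \<open>n\<close>, the number of visits
  up to \<open>n\<close> lies between \<open>n * p / (1 + e)\<close> and \<open>n * p * (1 + e)\<close>.\<close>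

lemma entry_time_products_asymptotically_equal:
  fixes T :: "'a::metric_space \<Rightarrow> 'a" and m :: "real \<Rightarrow> ennreal"
  assumes freq: "(\<lambda>n. real (card {k \<in> {1..n}. (T ^^ k) x \<in> A}) / n) \<longlonglongrightarrow> p" and "0 < p"
    and y: "y \<in> interior A" and orbit: "\<forall>k. (T ^^ k) x \<noteq> y" and "0 < e"
  shows "\<forall>\<^sub>F r in at_right 0.
      ennreal_of_enat (entry_time T (ball y r) x) * m r
        \<le> ennreal (1 + e) * (ennreal_of_enat (entry_time (first_return T A) (ball y r) x) * (m r / ennreal p))
    \<and> ennreal_of_enat (entry_time (first_return T A) (ball y r) x) * (m r / ennreal p)
        \<le> ennreal (1 + e) * (ennreal_of_enat (entry_time T (ball y r) x) * m r)"
proof -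
  let ?c = "\<lambda>n. card {k \<in> {1..n}. (T ^^ k) x \<in> A}"
  have inf: "infinite {k. 1 \<le> k \<and> (T ^^ k) x \<in> A}"
    using freq \<open>0 < p\<close> by (rule infinite_visits_of_frequency)
  have "p / (1 + e) < p" "p < p * (1 + e)"
    using \<open>0 < p\<close> \<open>0 < e\<close> by (auto simp: field_simps)
  then have "\<forall>\<^sub>F n in sequentially. p / (1 + e) < ?c n / n \<and> ?c n / n < p * (1 + e)"
    using order_tendstoD[OF freq] by (intro eventually_conj) auto
  then obtain N where N: "\<And>n. N \<le> n \<Longrightarrow> p / (1 + e) < ?c n / n \<and> ?c n / n < p * (1 + e)"
    by (auto simp: eventually_sequentially)
  have bounds: "real n \<le> (1 + e) * (?c n / p)" "?c n / p \<le> (1 + e) * real n" if "Suc N \<le> n" for n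
  proof -
    have "0 < real n" "N \<le> n"
      using that by auto
    then show "real n \<le> (1 + e) * (?c n / p)" "?c n / p \<le> (1 + e) * real n"
      using N[of n] \<open>0 < p\<close> \<open>0 < e\<close> by (auto simp: field_simps)
  qed
  show ?thesis
    using eventually_ball_subset[OF y] eventually_entry_time_ball_large[OF orbit, of "Suc N"]
  proof eventually_elim
    case (elim r)
    note induced = entry_time_first_return[OF inf elim(1)]
    have rearrange: "a * (m r / ennreal p) = a / ennreal p * m r" for a
      by (simp add: ennreal_divide_times mult.commute divide_ennreal_def mult.left_commute)
    show ?case
    proof (cases "entry_time T (ball y r) x")
      case (enat n)
      then have n: "Suc N \<le> n"
        using elim(2) by simp
      have "ennreal n \<le> ennreal (1 + e) * (ennreal (?c n) / ennreal p)"
           "ennreal (?c n) / ennreal p \<le> ennreal (1 + e) * ennreal n"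
        using bounds[OF n, THEN ennreal_leI] \<open>0 < p\<close> \<open>0 < e\<close>
        by (simp_all add: divide_ennreal ennreal_mult[symmetric] del: ennreal_plus)
      then show ?thesis
        unfolding rearrange induced enat
        by (auto simp: mult.assoc[symmetric] ennreal_of_nat_eq_real_of_nat intro!: mult_right_mono)
    next
      case infinity
      have "\<infinity> / ennreal p = \<infinity>" "ennreal (1 + e) * \<infinity> = \<infinity>"
        using \<open>0 < p\<close> \<open>0 < e\<close> by (auto simp: ennreal_top_divide ennreal_mult_top)
      then show ?thesis
        unfolding rearrange induced infinity
        by (simp add: mult.assoc[symmetric])
    qed
  qed
qed

theorem lemma15:
  fixes M :: "'a :: metric_space measure" and T :: "'a \<Rightarrow> 'a" and Xhat :: "'a set" and y :: 'a
  assumes "ergodic_metric_system M T"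
    and "Xhat \<in> sets M"
    and "emeasure M Xhat > 0"
    and "y \<in> interior Xhat"
    and "emeasure M {y} = 0"
  shows "AE x in induced_measure M Xhat.
      Limsup (at_right (0::real))
          (\<lambda>r. ennreal_of_enat (entry_time T (ball y r) x) * emeasure M (ball y r))
        = Limsup (at_right 0)
          (\<lambda>r. ennreal_of_enat (entry_time (first_return T Xhat) (ball y r) x)
             * emeasure (induced_measure M Xhat) (ball y r))
      \<and> Liminf (at_right (0::real))
          (\<lambda>r. ennreal_of_enat (entry_time T (ball y r) x) * emeasure M (ball y r))
        = Liminf (at_right 0)
          (\<lambda>r. ennreal_of_enat (entry_time (first_return T Xhat) (ball y r) x)
             * emeasure (induced_measure M Xhat) (ball y r))"
    (is "AE x in _. ?P x")
proof -
  interpret ergodic_metric_system M T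
    by fact
  define p where "p = prob Xhat"
  have p: "0 < p" "emeasure M Xhat = ennreal p"
    using \<open>emeasure M Xhat > 0\<close> by (auto simp: p_def emeasure_eq_measure)
  have "{y} \<in> sets M"
    by (simp add: sets_eq_borel)
  have "AE x in M. ?P x"
    using AE_visit_frequency[OF \<open>Xhat \<in> sets M\<close>]
      AE_orbit_avoids_null_set[OF \<open>emeasure M {y} = 0\<close> \<open>{y} \<in> sets M\<close>]
  proof eventually_elim
    case (elim x)
    let ?f = "\<lambda>r. ennreal_of_enat (entry_time T (ball y r) x) * emeasure M (ball y r)"
    let ?g = "\<lambda>r. ennreal_of_enat (entry_time (first_return T Xhat) (ball y r) x)
      * emeasure (induced_measure M Xhat) (ball y r)"
    have ball: "\<forall>\<^sub>F r in at_right 0. emeasure (induced_measure M Xhat) (ball y r)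
        = emeasure M (ball y r) / ennreal p"
      using eventually_ball_subset[OF \<open>y \<in> interior Xhat\<close>]
    proof eventually_elim
      case (elim r)
      then show ?case
        unfolding p(2)[symmetric]
        by (intro emeasure_induced_measure \<open>Xhat \<in> sets M\<close>) (simp add: sets_eq_borel)
    qed
    have "\<forall>\<^sub>F r in at_right 0. ?f r \<le> ennreal (1 + e) * ?g r \<and> ?g r \<le> ennreal (1 + e) * ?f r"
      if "0 < e" for e
      using ball entry_time_products_asymptotically_equal[OF elim(1)[folded p_def] p(1)
          \<open>y \<in> interior Xhat\<close> _ that, of "\<lambda>r. emeasure M (ball y r)"] elim(2)
      by (force elim: eventually_elim2)
    then have fg: "\<And>e. 0 < e \<Longrightarrow> \<forall>\<^sub>F r in at_right 0. ?f r \<le> ennreal (1 + e) * ?g r"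
      and gf: "\<And>e. 0 < e \<Longrightarrow> \<forall>\<^sub>F r in at_right 0. ?g r \<le> ennreal (1 + e) * ?f r"
      by (auto simp: eventually_conj_iff)
    show ?case
      using Limsup_le_of_eventually_le_mult[OF _ fg] Limsup_le_of_eventually_le_mult[OF _ gf]
      by (intro conjI antisym) auto
  qed
  then show ?thesis
    unfolding induced_measure_def
    using \<open>Xhat \<in> sets M\<close>
    by (subst AE_restrict_space_iff) (auto intro!: AE_uniform_measureI elim: eventually_mono)
qed

end
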